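(* Let $\varrho$ be an arbitrary congruence on an arbitrary semigroup $S$. Define $\varrho^{(0)}=\varrho$ and, for every $n\geq 1$, let $\varrho^{(n)}$ be the right colon congruence of $\varrho^{(n-1)}$. Then the sequence $$S/\varrho^{(0)},\ S/\varrho^{(1)},\ \dots,\ S/\varrho^{(n)},\ \dots$$ of factor semigroups is right regular.
   Context: For a congruence $\varrho$ on a semigroup $S$, the right colon congruence of $\varrho$ is the congruence $\varrho^{*}=\{(a,b)\in S\times S: (sa,sb)\in\varrho\text{ for all } s\in S\}$. For a semigroup $M$, $\theta_M$ is the congruence $\theta_M=\{(a,b)\in M\times M: xa=xb\text{ for all }x\in M\}$, and $M/\theta$ denotes the factor semigroup $M/\theta_M$. For a semigroup $A$, a nonempty set $\Lambda$ and a mapping $P:\Lambda\to A$, $\mathcal{M}(A;\Lambda;P)$ denotes the Rees matrix semigroup whose underlying set is $A\times\Lambda$, with multiplication $(s,\lambda)(t,\mu)=(sP(\lambda)t,\mu)$. A triple $A,B,C$ of semigroups is right regular if there are mappings $P:B\to A$ and $P':B\to C$ such that $\mathcal{M}(A;B;P)/\theta\cong\mathcal{M}(C;B;P')$ (in which $B$ is used as an index set). An infinite sequence $S_0,S_1,\dots,S_n,\dots$ of semigroups is right regular if, for every positive integer $n$, the triple $S_{n-1},S_n,S_{n+1}$ is right regular. *)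

theory Defs
  imports "HOL-Algebra.Congruence"
begin

record 'a sgrp = "'a partial_object" +
  sg_mult :: "'a \<Rightarrow> 'a \<Rightarrow> 'a" (infixl "\<cdot>\<index>" 70)

text \<open>Nonemptiness makes the carrier of a semigroup admissible as the index set of a
  Rees matrix semigroup.\<close>

locale sgrp =
  fixes S (structure)
  assumes nonempty: "carrier S \<noteq> {}"
    and closed: "\<lbrakk>a \<in> carrier S; b \<in> carrier S\<rbrakk> \<Longrightarrow> a \<cdot> b \<in> carrier S"
    and assoc: "\<lbrakk>a \<in> carrier S; b \<in> carrier S; c \<in> carrier S\<rbrakk>
      \<Longrightarrow> (a \<cdot> b) \<cdot> c = a \<cdot> (b \<cdot> c)"

definition sgrp_iso :: "('a, 'm) sgrp_scheme \<Rightarrow> ('b, 'n) sgrp_scheme \<Rightarrow> ('a \<Rightarrow> 'b) set"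
  where "sgrp_iso S T =
    {h. bij_betw h (carrier S) (carrier T) \<and>
        (\<forall>a\<in>carrier S. \<forall>b\<in>carrier S. h (a \<cdot>\<^bsub>S\<^esub> b) = h a \<cdot>\<^bsub>T\<^esub> h b)}"

definition sgrp_isomorphic :: "('a, 'm) sgrp_scheme \<Rightarrow> ('b, 'n) sgrp_scheme \<Rightarrow> bool"
  where "sgrp_isomorphic S T \<longleftrightarrow> sgrp_iso S T \<noteq> {}"

definition sgrp_congruence :: "('a, 'm) sgrp_scheme \<Rightarrow> ('a \<times> 'a) set \<Rightarrow> bool"
  where "sgrp_congruence S \<rho> \<longleftrightarrow>
    equiv (carrier S) \<rho> \<and>
    (\<forall>a b s. (a, b) \<in> \<rho> \<and> s \<in> carrier S \<longrightarrow>
      (s \<cdot>\<^bsub>S\<^esub> a, s \<cdot>\<^bsub>S\<^esub> b) \<in> \<rho> \<and> (a \<cdot>\<^bsub>S\<^esub> s, b \<cdot>\<^bsub>S\<^esub> s) \<in> \<rho>)"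

text \<open>If \<open>\<rho>\<close> is a congruence and \<open>X\<close>, \<open>Y\<close> are \<open>\<rho>\<close>-classes, all sets in the union below
  coincide: the product is the class of \<open>x \<cdot> y\<close> for any representatives \<open>x\<close>, \<open>y\<close>.\<close>

definition factor_sgrp :: "('a, 'm) sgrp_scheme \<Rightarrow> ('a \<times> 'a) set \<Rightarrow> 'a set sgrp"
  where "factor_sgrp S \<rho> =
    \<lparr>carrier = carrier S // \<rho>,
     sg_mult = (\<lambda>X Y. \<Union>x\<in>X. \<Union>y\<in>Y. \<rho> `` {x \<cdot>\<^bsub>S\<^esub> y})\<rparr>"

definition right_colon :: "('a, 'm) sgrp_scheme \<Rightarrow> ('a \<times> 'a) set \<Rightarrow> ('a \<times> 'a) set"
  where "right_colon S \<rho> =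
    {(a, b) \<in> carrier S \<times> carrier S. \<forall>s\<in>carrier S. (s \<cdot>\<^bsub>S\<^esub> a, s \<cdot>\<^bsub>S\<^esub> b) \<in> \<rho>}"

definition sgrp_theta :: "('a, 'm) sgrp_scheme \<Rightarrow> ('a \<times> 'a) set"
  where "sgrp_theta M =
    {(a, b) \<in> carrier M \<times> carrier M. \<forall>x\<in>carrier M. x \<cdot>\<^bsub>M\<^esub> a = x \<cdot>\<^bsub>M\<^esub> b}"

definition rees_matrix :: "('a, 'm) sgrp_scheme \<Rightarrow> 'l set \<Rightarrow> ('l \<Rightarrow> 'a) \<Rightarrow> ('a \<times> 'l) sgrp"
  where "rees_matrix A \<Lambda> P =
    \<lparr>carrier = carrier A \<times> \<Lambda>,
     sg_mult = (\<lambda>(s, l) (t, m). (s \<cdot>\<^bsub>A\<^esub> P l \<cdot>\<^bsub>A\<^esub> t, m))\<rparr>"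

definition right_regular_triple ::
    "('a, 'm) sgrp_scheme \<Rightarrow> ('b, 'n) sgrp_scheme \<Rightarrow> ('c, 'k) sgrp_scheme \<Rightarrow> bool"
  where "right_regular_triple A B C \<longleftrightarrow>
    sgrp A \<and> sgrp B \<and> sgrp C \<and>
    (\<exists>P P'. P \<in> carrier B \<rightarrow> carrier A \<and> P' \<in> carrier B \<rightarrow> carrier C \<and>
      sgrp_isomorphic
        (factor_sgrp (rees_matrix A (carrier B) P) (sgrp_theta (rees_matrix A (carrier B) P)))
        (rees_matrix C (carrier B) P'))"

definition right_regular_sequence :: "(nat \<Rightarrow> ('a, 'm) sgrp_scheme) \<Rightarrow> bool"
  where "right_regular_sequence T \<longleftrightarrow>
    (\<forall>n\<ge>1. right_regular_triple (T (n - 1)) (T n) (T (n + 1)))"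

primrec iterated_right_colon ::
    "('a, 'm) sgrp_scheme \<Rightarrow> ('a \<times> 'a) set \<Rightarrow> nat \<Rightarrow> ('a \<times> 'a) set"
  where
    "iterated_right_colon S \<rho> 0 = \<rho>"
  | "iterated_right_colon S \<rho> (Suc n) = right_colon S (iterated_right_colon S \<rho> n)"

end

theory Submission imports Defs begin

text \<open>
  Write \<open>R\<close> for the right colon congruence of \<open>\<rho>\<close> and \<open>Q\<close> for that of \<open>R\<close>, so that
  \<open>\<rho> \<subseteq> R \<subseteq> Q\<close> are congruences and three consecutive terms of the sequence are
  \<open>S/\<rho>\<close>, \<open>S/R\<close>, \<open>S/Q\<close>. Choose a representative \<open>r L\<close> in every \<open>R\<close>-class \<open>L\<close>, and
  use this one element for both sandwich mappings: \<open>P L\<close> is its \<open>\<rho>\<close>-class and \<open>P' L\<close>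
  its \<open>Q\<close>-class. Enlarging \<open>\<rho>\<close>-classes to \<open>Q\<close>-classes in the first coordinate is then a
  surjective homomorphism from the Rees matrix semigroup over \<open>S/\<rho>\<close> to the one over
  \<open>S/Q\<close>.

  The point is that its kernel is \<open>\<theta>\<close>. Two elements with first coordinates
  the classes of \<open>s\<close> and \<open>t\<close> and with equal second coordinates are \<open>\<theta>\<close>-related iff
  \<open>x \<cdot> r L \<cdot> s\<close> and \<open>x \<cdot> r L \<cdot> t\<close> are \<open>\<rho>\<close>-related for all \<open>x\<close> and \<open>L\<close>. Quantifying over
  \<open>x\<close> turns this into \<open>R\<close>-relatedness of \<open>r L \<cdot> s\<close> and \<open>r L \<cdot> t\<close> for all \<open>L\<close>. Modulo \<open>R\<close>
  the representatives exhaust \<open>S\<close>, so this says that \<open>s\<close> and \<open>t\<close> are \<open>Q\<close>-related. The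
  first isomorphism theorem finishes the argument, and induction along the sequence
  keeps every term a congruence.
\<close>

section \<open>Factor semigroups\<close>

lemma factor_carrier: "carrier (factor_sgrp S \<rho>) = (\<lambda>a. \<rho> `` {a}) ` carrier S"
  by (auto simp: factor_sgrp_def quotient_def)

lemma factor_mult_eqI:
  assumes "a \<in> X" "b \<in> Y" "\<And>x y. x \<in> X \<Longrightarrow> y \<in> Y \<Longrightarrow> \<rho> `` {x \<cdot>\<^bsub>S\<^esub> y} = Z"
  shows "X \<cdot>\<^bsub>factor_sgrp S \<rho>\<^esub> Y = Z"
proof -
  have "X \<cdot>\<^bsub>factor_sgrp S \<rho>\<^esub> Y = (\<Union>x\<in>X. \<Union>y\<in>Y. \<rho> `` {x \<cdot>\<^bsub>S\<^esub> y})"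
    by (simp add: factor_sgrp_def)
  also have "\<dots> = (\<Union>x\<in>X. \<Union>y\<in>Y. Z)"
    by (intro SUP_cong refl assms(3))
  also have "\<dots> = Z" using assms(1,2) by blast
  finally show ?thesis .
qed

text \<open>The first isomorphism theorem. The isomorphism sends a kernel class to the common
  \<open>h\<close>-value of its members.\<close>

lemma isomorphic_factor_kernel:
  assumes closed: "\<And>a b. a \<in> carrier M \<Longrightarrow> b \<in> carrier M \<Longrightarrow> a \<cdot>\<^bsub>M\<^esub> b \<in> carrier M"
    and onto: "h ` carrier M = carrier T"
    and hom: "\<And>a b. a \<in> carrier M \<Longrightarrow> b \<in> carrier M \<Longrightarrow> h (a \<cdot>\<^bsub>M\<^esub> b) = h a \<cdot>\<^bsub>T\<^esub> h b"
    and kernel: "\<sigma> = {(a, b) \<in> carrier M \<times> carrier M. h a = h b}"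
  shows "sgrp_isomorphic (factor_sgrp M \<sigma>) T"
proof -
  define g where "g X = the_elem (h ` X)" for X
  have cls: "\<sigma> `` {a} = {b \<in> carrier M. h b = h a}" if "a \<in> carrier M" for a
    using that by (auto simp: kernel)
  have g_cls: "g (\<sigma> `` {a}) = h a" if "a \<in> carrier M" for a
  proof -
    have "h ` (\<sigma> `` {a}) = {h a}"
      using that by (auto simp: cls)
    then show ?thesis by (simp add: g_def)
  qed
  have carr: "carrier (factor_sgrp M \<sigma>) = (\<lambda>a. \<sigma> `` {a}) ` carrier M"
    by (rule factor_carrier)
  have mult: "\<sigma> `` {a} \<cdot>\<^bsub>factor_sgrp M \<sigma>\<^esub> \<sigma> `` {b} = \<sigma> `` {a \<cdot>\<^bsub>M\<^esub> b}"
    if "a \<in> carrier M" "b \<in> carrier M" for a b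
  proof -
    have "\<sigma> `` {x \<cdot>\<^bsub>M\<^esub> y} = \<sigma> `` {a \<cdot>\<^bsub>M\<^esub> b}" if "x \<in> \<sigma> `` {a}" "y \<in> \<sigma> `` {b}" for x y
      using that \<open>a \<in> carrier M\<close> \<open>b \<in> carrier M\<close> by (simp add: cls closed hom)
    moreover have "a \<in> \<sigma> `` {a}" "b \<in> \<sigma> `` {b}"
      using that by (simp_all add: cls)
    ultimately show ?thesis
      by (intro factor_mult_eqI)
  qed
  have "bij_betw g (carrier (factor_sgrp M \<sigma>)) (carrier T)"
    unfolding bij_betw_def
  proof
    show "inj_on g (carrier (factor_sgrp M \<sigma>))"
    proof (rule inj_onI)
      fix X Y
      assume "X \<in> carrier (factor_sgrp M \<sigma>)" "Y \<in> carrier (factor_sgrp M \<sigma>)" "g X = g Y"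
      then obtain a b where "a \<in> carrier M" "X = \<sigma> `` {a}" "b \<in> carrier M" "Y = \<sigma> `` {b}"
        unfolding carr by blast
      with \<open>g X = g Y\<close> g_cls[of a] g_cls[of b] show "X = Y" by (simp add: cls)
    qed
    show "g ` carrier (factor_sgrp M \<sigma>) = carrier T"
      unfolding carr image_image onto[symmetric] by (simp add: g_cls)
  qed
  moreover have "\<forall>X\<in>carrier (factor_sgrp M \<sigma>). \<forall>Y\<in>carrier (factor_sgrp M \<sigma>).
      g (X \<cdot>\<^bsub>factor_sgrp M \<sigma>\<^esub> Y) = g X \<cdot>\<^bsub>T\<^esub> g Y"
    unfolding carr by (simp add: mult g_cls closed hom)
  ultimately show ?thesis
    unfolding sgrp_isomorphic_def sgrp_iso_def by blast
qed

lemma sgrp_congruence_equiv: "sgrp_congruence S \<rho> \<Longrightarrow> equiv (carrier S) \<rho>"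
  by (simp add: sgrp_congruence_def)

lemma congruence_class_eq_iff:
  assumes "sgrp_congruence S \<rho>" "a \<in> carrier S" "b \<in> carrier S"
  shows "\<rho> `` {a} = \<rho> `` {b} \<longleftrightarrow> (a, b) \<in> \<rho>"
  using eq_equiv_class_iff[OF sgrp_congruence_equiv[OF assms(1)] assms(2,3)] .

lemma congruence_mult:
  assumes "sgrp_congruence S \<rho>" "(a, a') \<in> \<rho>" "(b, b') \<in> \<rho>"
  shows "(a \<cdot>\<^bsub>S\<^esub> b, a' \<cdot>\<^bsub>S\<^esub> b') \<in> \<rho>"
proof -
  have eq: "equiv (carrier S) \<rho>" by (rule sgrp_congruence_equiv[OF assms(1)])
  then have "a' \<in> carrier S" "b \<in> carrier S"
    using assms(2,3) by (auto simp: equiv_def refl_on_def)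
  then have "(a \<cdot>\<^bsub>S\<^esub> b, a' \<cdot>\<^bsub>S\<^esub> b) \<in> \<rho>" "(a' \<cdot>\<^bsub>S\<^esub> b, a' \<cdot>\<^bsub>S\<^esub> b') \<in> \<rho>"
    using assms unfolding sgrp_congruence_def by blast+
  then show ?thesis using eq by (meson equivE transD)
qed

lemma factor_mult:
  assumes "sgrp_congruence S \<rho>" "a \<in> carrier S" "b \<in> carrier S"
  shows "\<rho> `` {a} \<cdot>\<^bsub>factor_sgrp S \<rho>\<^esub> \<rho> `` {b} = \<rho> `` {a \<cdot>\<^bsub>S\<^esub> b}"
proof -
  have eq: "equiv (carrier S) \<rho>" by (rule sgrp_congruence_equiv[OF assms(1)])
  have "\<rho> `` {x \<cdot>\<^bsub>S\<^esub> y} = \<rho> `` {a \<cdot>\<^bsub>S\<^esub> b}" if "x \<in> \<rho> `` {a}" "y \<in> \<rho> `` {b}" for x y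
    using that equiv_class_eq[OF eq congruence_mult[OF assms(1)], of a x b y] by simp
  moreover have "a \<in> \<rho> `` {a}" "b \<in> \<rho> `` {b}"
    using assms(2,3) equiv_class_self[OF eq] by blast+
  ultimately show ?thesis
    by (intro factor_mult_eqI)
qed

lemma sgrp_factor:
  assumes "sgrp S" "sgrp_congruence S \<rho>"
  shows "sgrp (factor_sgrp S \<rho>)"
proof -
  interpret sgrp S by fact
  show ?thesis
    by standard
      (use nonempty in \<open>auto simp: factor_carrier factor_mult[OF assms(2)] closed assoc\<close>)
qed

section \<open>Right colon congruences\<close>

lemma right_colon_iff:
  "(a, b) \<in> right_colon S \<rho> \<longleftrightarrow>
    a \<in> carrier S \<and> b \<in> carrier S \<and> (\<forall>s\<in>carrier S. (s \<cdot>\<^bsub>S\<^esub> a, s \<cdot>\<^bsub>S\<^esub> b) \<in> \<rho>)"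
  by (simp add: right_colon_def)

lemma congruence_subset_right_colon:
  assumes "sgrp_congruence S \<rho>"
  shows "\<rho> \<subseteq> right_colon S \<rho>"
  using assms by (auto simp: right_colon_iff sgrp_congruence_def equiv_def refl_on_def)

text \<open>For left compatibility, multiplying a related pair by \<open>s\<close> and testing it with \<open>x\<close> is
  testing the original pair with \<open>x \<cdot> s\<close>. For right compatibility, testing with \<open>x\<close> and
  then multiplying by \<open>s\<close> on the right stays inside \<open>\<rho>\<close>.\<close>

lemma sgrp_congruence_right_colon:
  fixes S (structure)
  assumes "sgrp S" "sgrp_congruence S \<rho>"
  shows "sgrp_congruence S (right_colon S \<rho>)"
proof -
  interpret sgrp S by fact
  have eq: "equiv (carrier S) \<rho>" by (rule sgrp_congruence_equiv[OF assms(2)])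
  have "equiv (carrier S) (right_colon S \<rho>)"
  proof (rule equivI)
    show "right_colon S \<rho> \<subseteq> carrier S \<times> carrier S"
      by (auto simp: right_colon_iff)
    show "refl_on (carrier S) (right_colon S \<rho>)"
      using eq closed by (auto simp: refl_on_def right_colon_iff equiv_def)
    show "sym (right_colon S \<rho>)"
      using eq unfolding equiv_def sym_def by (auto simp: right_colon_iff)
    show "trans (right_colon S \<rho>)"
      using eq unfolding equiv_def trans_def right_colon_iff by blast
  qed
  moreover have "(s \<cdot> a, s \<cdot> b) \<in> right_colon S \<rho>"
    if "(a, b) \<in> right_colon S \<rho>" "s \<in> carrier S" for a b s
  proof -
    have "(x \<cdot> (s \<cdot> a), x \<cdot> (s \<cdot> b)) \<in> \<rho>" if "x \<in> carrier S" for x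
      using that \<open>(a, b) \<in> _\<close> \<open>s \<in> carrier S\<close> closed[of x s]
      by (simp add: right_colon_iff flip: assoc)
    with that closed show ?thesis by (simp add: right_colon_iff)
  qed
  moreover have "(a \<cdot> s, b \<cdot> s) \<in> right_colon S \<rho>"
    if "(a, b) \<in> right_colon S \<rho>" "s \<in> carrier S" for a b s
  proof -
    have "(x \<cdot> (a \<cdot> s), x \<cdot> (b \<cdot> s)) \<in> \<rho>" if "x \<in> carrier S" for x
    proof -
      have "((x \<cdot> a) \<cdot> s, (x \<cdot> b) \<cdot> s) \<in> \<rho>"
        using that \<open>(a, b) \<in> _\<close> \<open>s \<in> carrier S\<close> assms(2)
        by (simp add: right_colon_iff sgrp_congruence_def)
      then show ?thesis
        using that \<open>(a, b) \<in> _\<close> \<open>s \<in> carrier S\<close> by (simp add: right_colon_iff assoc)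
    qed
    with that closed show ?thesis by (simp add: right_colon_iff)
  qed
  ultimately show ?thesis by (simp add: sgrp_congruence_def)
qed

text \<open>Let \<open>R\<close> be the right colon congruence of \<open>\<rho>\<close>. To test membership in the right colon
  congruence of \<open>R\<close>, left factors from a set \<open>D\<close> meeting every \<open>R\<close>-class suffice, because
  \<open>R\<close> is right compatible: replacing a left factor by an \<open>R\<close>-related one does not change
  the \<open>R\<close>-class of the product. Quantifying over \<open>x\<close> expresses \<open>R\<close> through \<open>\<rho>\<close>.\<close>

lemma right_colon_twice_iff:
  fixes S (structure)
  assumes "sgrp S" "sgrp_congruence S \<rho>" "s \<in> carrier S" "t \<in> carrier S"
    and D: "D \<subseteq> carrier S" "\<And>q. q \<in> carrier S \<Longrightarrow> \<exists>p\<in>D. (q, p) \<in> right_colon S \<rho>"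
  shows "(s, t) \<in> right_colon S (right_colon S \<rho>) \<longleftrightarrow>
    (\<forall>x\<in>carrier S. \<forall>p\<in>D. (x \<cdot> p \<cdot> s, x \<cdot> p \<cdot> t) \<in> \<rho>)"
proof -
  interpret sgrp S by fact
  let ?R = "right_colon S \<rho>"
  have congR: "sgrp_congruence S ?R" by (rule sgrp_congruence_right_colon[OF assms(1,2)])
  have eqR: "equiv (carrier S) ?R" by (rule sgrp_congruence_equiv[OF congR])
  have "(\<forall>x\<in>carrier S. \<forall>p\<in>D. (x \<cdot> p \<cdot> s, x \<cdot> p \<cdot> t) \<in> \<rho>) \<longleftrightarrow>
      (\<forall>p\<in>D. (p \<cdot> s, p \<cdot> t) \<in> ?R)"
    using assms(3,4) D(1) by (auto simp: right_colon_iff closed assoc subset_iff)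
  also have "\<dots> \<longleftrightarrow> (\<forall>q\<in>carrier S. (q \<cdot> s, q \<cdot> t) \<in> ?R)"
  proof
    assume *: "\<forall>p\<in>D. (p \<cdot> s, p \<cdot> t) \<in> ?R"
    show "\<forall>q\<in>carrier S. (q \<cdot> s, q \<cdot> t) \<in> ?R"
    proof
      fix q assume "q \<in> carrier S"
      then obtain p where p: "p \<in> D" "(q, p) \<in> ?R" using D(2) by blast
      then have "(q \<cdot> s, p \<cdot> s) \<in> ?R" "(q \<cdot> t, p \<cdot> t) \<in> ?R"
        using congR assms(3,4) by (auto simp: sgrp_congruence_def)
      with * p(1) eqR show "(q \<cdot> s, q \<cdot> t) \<in> ?R"
        by (meson equivE symD transD)
    qed
  qed (use D(1) in blast)
  finally show ?thesis
    using assms(3,4) by (simp add: right_colon_iff[of s t S ?R])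
qed

section \<open>Right regularity\<close>

theorem right_regular_triple_right_colon:
  fixes S (structure)
  assumes "sgrp S" "sgrp_congruence S \<rho>"
  shows "right_regular_triple (factor_sgrp S \<rho>) (factor_sgrp S (right_colon S \<rho>))
    (factor_sgrp S (right_colon S (right_colon S \<rho>)))"
proof -
  interpret sgrp S by fact
  define R where "R = right_colon S \<rho>"
  define Q where "Q = right_colon S R"
  let ?A = "factor_sgrp S \<rho>" and ?B = "factor_sgrp S R" and ?C = "factor_sgrp S Q"
  note cong = assms(2)
  have congR: "sgrp_congruence S R"
    unfolding R_def by (rule sgrp_congruence_right_colon[OF assms])
  have congQ: "sgrp_congruence S Q"
    unfolding Q_def by (rule sgrp_congruence_right_colon[OF assms(1) congR])
  have "\<rho> \<subseteq> Q"
    using congruence_subset_right_colon[OF cong] congruence_subset_right_colon[OF congR]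
    unfolding Q_def R_def by blast
  define r where "r L = (SOME x. x \<in> L)" for L :: "'a set"
  have r: "(a, r (R `` {a})) \<in> R" if "a \<in> carrier S" for a
    using equiv_class_self[OF sgrp_congruence_equiv[OF congR] that]
      someI[of "\<lambda>x. x \<in> R `` {a}" a]
    by (simp add: r_def)
  have r_in: "r L \<in> carrier S" if "L \<in> carrier ?B" for L
    using that r by (auto simp: factor_carrier R_def right_colon_iff)
  define P where "P L = \<rho> `` {r L}" for L
  define P' where "P' L = Q `` {r L}" for L
  let ?M = "rees_matrix ?A (carrier ?B) P" and ?N = "rees_matrix ?C (carrier ?B) P'"
  have M_mult: "(\<rho> `` {s}, L) \<cdot>\<^bsub>?M\<^esub> (\<rho> `` {t}, K) = (\<rho> `` {s \<cdot> r L \<cdot> t}, K)"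
    if "s \<in> carrier S" "t \<in> carrier S" "L \<in> carrier ?B" for s t L K
    using that r_in[OF that(3)]
    by (simp add: rees_matrix_def P_def factor_mult[OF cong] closed)
  have N_mult: "(Q `` {s}, L) \<cdot>\<^bsub>?N\<^esub> (Q `` {t}, K) = (Q `` {s \<cdot> r L \<cdot> t}, K)"
    if "s \<in> carrier S" "t \<in> carrier S" "L \<in> carrier ?B" for s t L K
    using that r_in[OF that(3)]
    by (simp add: rees_matrix_def P'_def factor_mult[OF congQ] closed)
  have M_carrier: "carrier ?M = (\<lambda>s. \<rho> `` {s}) ` carrier S \<times> carrier ?B"
    and N_carrier: "carrier ?N = (\<lambda>s. Q `` {s}) ` carrier S \<times> carrier ?B"
    by (simp_all add: rees_matrix_def factor_carrier)
  define h where "h = (\<lambda>(X, L :: 'a set). (Q `` X, L))"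
  \<comment> \<open>the union of the \<open>Q\<close>-classes meeting a \<open>\<rho>\<close>-class is a single \<open>Q\<close>-class\<close>
  have h: "h (\<rho> `` {s}, L) = (Q `` {s}, L)" if "s \<in> carrier S" for s L
  proof -
    have "Q `` {x} = Q `` {s}" if "x \<in> \<rho> `` {s}" for x
      using that \<open>\<rho> \<subseteq> Q\<close> equiv_class_eq[OF sgrp_congruence_equiv[OF congQ], of s x] by blast
    moreover have "s \<in> \<rho> `` {s}"
      using equiv_class_self[OF sgrp_congruence_equiv[OF cong] that] .
    ultimately have "Q `` (\<rho> `` {s}) = Q `` {s}" by blast
    then show ?thesis by (simp add: h_def)
  qed
  have theta: "((\<rho> `` {s}, L), (\<rho> `` {t}, K)) \<in> sgrp_theta ?M \<longleftrightarrow> (s, t) \<in> Q \<and> L = K"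
    if st: "s \<in> carrier S" "t \<in> carrier S" "L \<in> carrier ?B" "K \<in> carrier ?B" for s t L K
  proof -
    \<comment> \<open>some multiplier must exist for \<open>\<theta>\<close> to detect the second coordinate\<close>
    have ne: "carrier S \<noteq> {}" "carrier ?B \<noteq> {}"
      using nonempty by (simp_all add: factor_carrier)
    have "((\<rho> `` {s}, L), (\<rho> `` {t}, K)) \<in> sgrp_theta ?M \<longleftrightarrow>
        (\<forall>x\<in>carrier S. \<forall>J\<in>carrier ?B.
          (\<rho> `` {x}, J) \<cdot>\<^bsub>?M\<^esub> (\<rho> `` {s}, L) = (\<rho> `` {x}, J) \<cdot>\<^bsub>?M\<^esub> (\<rho> `` {t}, K))"
      using st unfolding sgrp_theta_def M_carrier by simp
    also have "\<dots> \<longleftrightarrow> (\<forall>x\<in>carrier S. \<forall>J\<in>carrier ?B.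
        (x \<cdot> r J \<cdot> s, x \<cdot> r J \<cdot> t) \<in> \<rho> \<and> L = K)"
      using st r_in by (simp add: M_mult congruence_class_eq_iff[OF cong] closed)
    also have "\<dots> \<longleftrightarrow> (\<forall>x\<in>carrier S. \<forall>p\<in>r ` carrier ?B. (x \<cdot> p \<cdot> s, x \<cdot> p \<cdot> t) \<in> \<rho>) \<and> L = K"
      using ne by blast
    also have "(\<forall>x\<in>carrier S. \<forall>p\<in>r ` carrier ?B. (x \<cdot> p \<cdot> s, x \<cdot> p \<cdot> t) \<in> \<rho>) \<longleftrightarrow> (s, t) \<in> Q"
      unfolding Q_def R_def
    proof (rule right_colon_twice_iff[OF assms st(1,2), symmetric], fold R_def)
      show "r ` carrier ?B \<subseteq> carrier S" using r_in by blast
      show "\<exists>p\<in>r ` carrier ?B. (q, p) \<in> R" if "q \<in> carrier S" for q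
        using that r[OF that] by (auto simp: factor_carrier)
    qed
    finally show ?thesis .
  qed
  have "sgrp_isomorphic (factor_sgrp ?M (sgrp_theta ?M)) ?N"
  proof (rule isomorphic_factor_kernel[where h = h])
    show "a \<cdot>\<^bsub>?M\<^esub> b \<in> carrier ?M" if "a \<in> carrier ?M" "b \<in> carrier ?M" for a b
      using that r_in unfolding M_carrier by (auto simp: M_mult closed)
    show "h ` carrier ?M = carrier ?N"
    proof -
      have "(Q `` {s}, L) \<in> h ` carrier ?M" if "s \<in> carrier S" "L \<in> carrier ?B" for s L
        using that
        by (intro image_eqI[where x = "(\<rho> `` {s}, L)"]) (auto simp: h M_carrier)
      then show ?thesis
        by (auto simp: M_carrier N_carrier h)
    qed
    show "h (a \<cdot>\<^bsub>?M\<^esub> b) = h a \<cdot>\<^bsub>?N\<^esub> h b" if "a \<in> carrier ?M" "b \<in> carrier ?M" for a b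
      using that r_in unfolding M_carrier by (auto simp: M_mult N_mult h closed)
    show "sgrp_theta ?M = {(a, b) \<in> carrier ?M \<times> carrier ?M. h a = h b}"
    proof -
      have "(a, b) \<in> sgrp_theta ?M \<longleftrightarrow> h a = h b"
        if "a \<in> carrier ?M" "b \<in> carrier ?M" for a b
        using that unfolding M_carrier
        by (auto simp: theta h congruence_class_eq_iff[OF congQ])
      moreover have "sgrp_theta ?M \<subseteq> carrier ?M \<times> carrier ?M"
        by (auto simp: sgrp_theta_def)
      ultimately show ?thesis by blast
    qed
  qed
  moreover have "P \<in> carrier ?B \<rightarrow> carrier ?A" "P' \<in> carrier ?B \<rightarrow> carrier ?C"
    using r_in by (auto simp: P_def P'_def factor_carrier)
  ultimately show ?thesis
    unfolding right_regular_triple_def R_def[symmetric] Q_def[symmetric]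
    using sgrp_factor[OF assms(1)] cong congR congQ by blast
qed

lemma sgrp_congruence_iterated_right_colon:
  assumes "sgrp S" "sgrp_congruence S \<rho>"
  shows "sgrp_congruence S (iterated_right_colon S \<rho> n)"
  by (induction n) (simp_all add: assms sgrp_congruence_right_colon)

theorem theorem3:
  fixes S :: "('a, 'm) sgrp_scheme" and \<rho> :: "('a \<times> 'a) set"
  assumes "sgrp S" and "sgrp_congruence S \<rho>"
  shows "right_regular_sequence (\<lambda>n. factor_sgrp S (iterated_right_colon S \<rho> n))"
  unfolding right_regular_sequence_def
proof (intro allI impI)
  fix n :: nat
  assume "1 \<le> n"
  then obtain m where "n = Suc m" by (cases n) auto
  then show "right_regular_triple (factor_sgrp S (iterated_right_colon S \<rho> (n - 1)))
      (factor_sgrp S (iterated_right_colon S \<rho> n))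
      (factor_sgrp S (iterated_right_colon S \<rho> (n + 1)))"
    using right_regular_triple_right_colon[OF assms(1)
        sgrp_congruence_iterated_right_colon[OF assms, of m]]
    by simp
qed

end
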